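(* Assume the Phase Transition Conjecture (stated in the context) is true. Let $A$ be a nonzero real symmetric matrix with rank $r(A)$ and let $\tau_c$ be its critical threshold. Suppose the equation $$r(A)\ln\Big(1+\frac{t}{r(A)\|A\|}\Big)-\frac{t}{\|A\|}+2\kappa\min\Big\{\frac{t^2}{\|A\|_2^2},\frac{t}{\|A\|}\Big\}=0$$ has a positive solution in $t$, and let $\hat\tau_c$ be its largest positive solution. Here $\kappa=b^*/4\approx0.1457$, with $b^*$ the unique solution in $(0,1)$ of $\ln(1-b)=-\frac32 b$. Then $\tau_c\le\hat\tau_c$.
   Context: For a symmetric matrix $A$ with eigenvalues $\lambda_i$: $\|A\|=\max_i|\lambda_i|$, $\|A\|_p=(\sum_i|\lambda_i|^p)^{1/p}$. For integers $m\ge1$, $0<b<1$, $t>0$: $$\theta_m(b)=-\frac{1}{b^{m+1}}\Big(\ln(1-b)+b+\cdots+\frac{b^m}{m}\Big),\qquad \kappa_m(b)=\frac{m}{2(m+1)}\min\Big\{\frac{1}{((m+1)\theta_m(b))^{1/m}},b\Big\},$$ $$\Lambda_m(t,b)=\frac{r(A)}{2}\sum_{k=2}^m\frac{b^k}{k}-\kappa_m(b)\min\Big\{\frac{t^{1+\frac1m}}{\|A\|_{m+1}^{1+\frac1m}},\frac{t}{\|A\|}\Big\}.$$ Phase Transition Conjecture: for every (nonzero) symmetric matrix $A$ there exists a critical threshold $\tau_c\ge0$ such that if $0<t<\tau_c$, then $\inf_{b\in(0,1)}e^{\Lambda_m(t,b)}$ is the smallest, among all $m\ge1$, for $m=1$;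 and if $t>\tau_c$, then $\lim_{m\to\infty}\inf_{b\in(0,1)}e^{\Lambda_m(t,b)}$ exists and is smaller than $\inf_{b\in(0,1)}e^{\Lambda_m(t,b)}$ for every $m\ge1$. Moreover, if every eigenvalue of $A$ has the same absolute value, then $\tau_c=0$. *)

theory Defs
  imports
    Complex_Main
    "Jordan_Normal_Form.Spectral_Radius"
    "Jordan_Normal_Form.DL_Rank"
begin

definition sym_mat :: "nat \<Rightarrow> real mat \<Rightarrow> bool" where
  "sym_mat n A \<longleftrightarrow> A \<in> carrier_mat n n \<and> transpose_mat A = A"

(* The dimension argument of vec_space.rank is the length of the columns. *)
definition mat_rank :: "real mat \<Rightarrow> nat" where
  "mat_rank A = vec_space.rank (dim_row A) A"

(* Real eigenvalues with algebraic multiplicity.  For a real symmetric matrix the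
   characteristic polynomial splits over the reals, so these are all n eigenvalues. *)
definition eigs :: "real mat \<Rightarrow> real multiset" where
  "eigs A = proots (char_poly A)"

definition op_norm :: "real mat \<Rightarrow> real" where
  "op_norm A = Max (abs ` spectrum A)"

definition schatten_norm :: "real \<Rightarrow> real mat \<Rightarrow> real" where
  "schatten_norm p A = (\<Sum>l\<in>#eigs A. \<bar>l\<bar> powr p) powr (1 / p)"

definition theta :: "nat \<Rightarrow> real \<Rightarrow> real" where
  "theta m b = - (1 / b ^ (m + 1)) * (ln (1 - b) + (\<Sum>k=1..m. b ^ k / real k))"

definition kappa :: "nat \<Rightarrow> real \<Rightarrow> real" where
  "kappa m b = real m / (2 * (real m + 1))
     * min (1 / ((real m + 1) * theta m b) powr (1 / real m)) b"

definition Lambda :: "real mat \<Rightarrow> nat \<Rightarrow> real \<Rightarrow> real \<Rightarrow> real" where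
  "Lambda A m t b = real (mat_rank A) / 2 * (\<Sum>k=2..m. b ^ k / real k)
     - kappa m b * min (t powr (1 + 1 / real m)
                          / schatten_norm (real m + 1) A powr (1 + 1 / real m))
                       (t / op_norm A)"

definition tail_bound :: "real mat \<Rightarrow> nat \<Rightarrow> real \<Rightarrow> real" where
  "tail_bound A m t = (INF b\<in>{0<..<1}. exp (Lambda A m t b))"

(* There is at most one such threshold: for t strictly between two of them, the limit would
   be both at least and strictly below the value at m = 1. *)
definition is_critical_threshold :: "real mat \<Rightarrow> real \<Rightarrow> bool" where
  "is_critical_threshold A \<tau> \<longleftrightarrow> 0 \<le> \<tau> \<and>
     (\<forall>t. 0 < t \<and> t < \<tau> \<longrightarrow> (\<forall>m\<ge>1. tail_bound A 1 t \<le> tail_bound A m t)) \<and>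
     (\<forall>t. t > \<tau> \<longrightarrow>
        (\<exists>L. (\<lambda>m. tail_bound A m t) \<longlonglongrightarrow> L \<and> (\<forall>m\<ge>1. L < tail_bound A m t)))"

definition critical_threshold :: "real mat \<Rightarrow> real" where
  "critical_threshold A = (THE \<tau>. is_critical_threshold A \<tau>)"

definition phase_transition_conjecture :: bool where
  "phase_transition_conjecture \<longleftrightarrow>
     (\<forall>n A. sym_mat n A \<and> A \<noteq> 0\<^sub>m n n \<longrightarrow>
        (\<exists>\<tau>. is_critical_threshold A \<tau> \<and>
           ((\<forall>x y. eigenvalue A x \<and> eigenvalue A y \<longrightarrow> \<bar>x\<bar> = \<bar>y\<bar>) \<longrightarrow> \<tau> = 0)))"

definition b_star :: real where
  "b_star = (THE b. 0 < b \<and> b < 1 \<and> ln (1 - b) = - (3 / 2) * b)"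

definition kappa_star :: real where
  "kappa_star = b_star / 4"

definition threshold_eq :: "real mat \<Rightarrow> real \<Rightarrow> bool" where
  "threshold_eq A t \<longleftrightarrow>
     real (mat_rank A) * ln (1 + t / (real (mat_rank A) * op_norm A)) - t / op_norm A
       + 2 * kappa_star * min (t\<^sup>2 / (schatten_norm 2 A)\<^sup>2) (t / op_norm A) = 0"

(* Whenever there is a positive solution, a largest one exists: the left-hand side is
   continuous and tends to minus infinity as t grows. *)
definition largest_solution :: "real mat \<Rightarrow> real" where
  "largest_solution A = (GREATEST t. 0 < t \<and> threshold_eq A t)"

end

theory Submission
  imports Defs "HOL-Analysis.Complex_Transcendental" "HOL-Real_Asymp.Real_Asymp"
begin

text \<open>
Write $s = \|A\|$, $r = r(A)$ and $M(t) = \min\{t^2/\|A\|_2^2,\, t/s\}$.  At $m = 1$ the exponent is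
$\Lambda_1(t,b) = -\kappa_1(b)\,M(t)$, and $\kappa_1$ has maximum $\kappa = b^*/4$, because $b^*$ is the
point at which the two arguments of the minimum in $\kappa_1$ agree.  Hence the bound for $m = 1$ is at
least $e^{-\kappa M(t)}$ (\<open>tail_bound_1_ge\<close>).

For fixed $b$ and $m \to \infty$, both $\kappa_m(b) \to b/2$ and $\|A\|_{m+1} \to s$, so that
$\Lambda_m(t,b)$ tends to $\frac r2(-\ln(1-b) - b) - \frac b2 \cdot \frac ts$ (\<open>Lambda_tendsto\<close>).
This is smallest at $b = t/(rs+t)$, with value $\frac12(r\ln(1+\frac t{rs}) - \frac ts)$.
So if the left-hand side of the threshold equation is negative at $t$, then some $m$ gives a strictly
better bound at $t$ than $m = 1$ (\<open>limit_beats_first_bound\<close>), which excludes $t < \tau_c$.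

The left-hand side is continuous in $t$ and eventually negative, as $2\kappa < 1$; by the intermediate
value theorem it is negative at every $t > \hat\tau_c$ (\<open>largest_zero\<close>).
Therefore no $t$ can satisfy $\hat\tau_c < t < \tau_c$.

The division by $rs$ needs two positivity facts.  The operator norm of $A$ is positive (\<open>op_norm_pos\<close>), since a
nonzero symmetric matrix has a nonzero real eigenvalue.  The rank is positive because the equation with
$r = 0$ has no positive solution (\<open>rank_pos_if_solution\<close>).
\<close>

section \<open>A nonzero symmetric matrix has positive operator norm\<close>

definition trace_mat :: "'a::comm_ring_1 mat \<Rightarrow> 'a" where
  "trace_mat A = (\<Sum>i<dim_row A. A $$ (i, i))"

lemma trace_mat_mult:
  assumes "A \<in> carrier_mat n n" "B \<in> carrier_mat n n"
  shows "trace_mat (A * B) = (\<Sum>i<n. \<Sum>j<n. A $$ (i, j) * B $$ (j, i))"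
  using assms by (auto simp: trace_mat_def scalar_prod_def atLeast0LessThan intro!: sum.cong)

lemma trace_mat_mult_commute:
  assumes "A \<in> carrier_mat n n" "B \<in> carrier_mat n n"
  shows "trace_mat (A * B) = trace_mat (B * A)"
  unfolding trace_mat_mult[OF assms] trace_mat_mult[OF assms(2,1)]
  by (subst sum.swap) (simp add: mult.commute)

lemma trace_mat_similar:
  assumes "similar_mat A B"
  shows "trace_mat A = trace_mat B"
proof -
  obtain n P Q where c: "A \<in> carrier_mat n n" "B \<in> carrier_mat n n"
      "P \<in> carrier_mat n n" "Q \<in> carrier_mat n n"
    and QP: "Q * P = 1\<^sub>m n" and A: "A = P * B * Q"
    using similar_matD[OF assms] by auto
  have "trace_mat A = trace_mat (P * (B * Q))"
    unfolding A using c by (subst assoc_mult_mat) auto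
  also have "\<dots> = trace_mat (B * Q * P)"
    using c by (intro trace_mat_mult_commute) auto
  also have "B * Q * P = B"
    using c by (subst assoc_mult_mat) (auto simp: QP)
  finally show ?thesis .
qed

lemma trace_square_similar:
  assumes "similar_mat A B"
  shows "trace_mat (A * A) = trace_mat (B * B)"
proof -
  obtain P Q where PQ: "similar_mat_wit A B P Q"
    using assms by (auto simp: similar_mat_def)
  have "similar_mat_wit (A ^\<^sub>m 2) (B ^\<^sub>m 2) P Q"
    by (rule similar_mat_wit_pow[OF PQ])
  then have "similar_mat (A ^\<^sub>m 2) (B ^\<^sub>m 2)"
    by (auto simp: similar_mat_def)
  moreover have "C ^\<^sub>m 2 = C * C" if "C \<in> carrier_mat n n" for C :: "'a mat" and n
    using that by (simp add: numeral_2_eq_2)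
  moreover obtain n where "A \<in> carrier_mat n n" "B \<in> carrier_mat n n"
    using similar_matD[OF assms] by auto
  ultimately show ?thesis
    using trace_mat_similar by metis
qed

text \<open>
The trace of $C^2$ can be read off a Schur form of $C$.  If all eigenvalues were zero, that form would be
strictly upper triangular, and so would its square.
\<close>

lemma nonzero_eigenvalue_if_trace_square_nonzero:
  fixes C :: "complex mat"
  assumes C: "C \<in> carrier_mat n n" and tr: "trace_mat (C * C) \<noteq> 0"
  obtains z where "eigenvalue C z" "z \<noteq> 0"
proof -
  obtain es where es: "char_poly C = (\<Prod>a\<leftarrow>es. [:- a, 1:])"
    using char_poly_factorized[OF C] by blast
  then obtain B where B: "B \<in> carrier_mat n n" "upper_triangular B" and sim: "similar_mat C B"
    using schur_decomposition_exists[OF C es] by blast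
  have diag: "eigenvalue C (B $$ (i, i))" if "i < n" for i
  proof -
    have "B $$ (i, i) \<in> set (diag_mat B)"
      using that B by (auto simp: diag_mat_def)
    then have "poly (char_poly B) (B $$ (i, i)) = 0"
      unfolding char_poly_upper_triangular[OF B] poly_prod_list_zero_iff by force
    then show ?thesis
      by (simp add: eigenvalue_root_char_poly[OF C] char_poly_similar[OF sim])
  qed
  have "\<exists>i<n. B $$ (i, i) \<noteq> 0"
  proof (rule ccontr)
    assume zero: "\<not> ?thesis"
    have zero_prod: "B $$ (i, j) * B $$ (j, i) = 0" if "i < n" "j < n" for i j
      using that zero upper_triangularD[OF B(2), of i j] upper_triangularD[OF B(2), of j i] B(1)
      by (cases i j rule: linorder_cases) auto
    have "trace_mat (B * B) = 0"
      unfolding trace_mat_mult[OF B(1) B(1)] by (intro sum.neutral ballI zero_prod) auto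
    with tr show False
      by (simp add: trace_square_similar[OF sim])
  qed
  with diag that show thesis by blast
qed

lemma sym_mat_index:
  assumes "sym_mat n A" "i < n" "j < n"
  shows "A $$ (i, j) = A $$ (j, i)"
proof -
  have A: "A \<in> carrier_mat n n" and sy: "transpose_mat A = A"
    using assms by (auto simp: sym_mat_def)
  have "transpose_mat A $$ (i, j) = A $$ (j, i)" using A assms(2,3) by auto
  with sy show ?thesis by simp
qed

text \<open>
For an eigenvector $v$ the number $q = v^* A v$ equals $z \|v\|^2$, and symmetry of the real
matrix $A$ makes $q$ equal to its own conjugate.
\<close>

lemma eigenvalue_of_symmetric_is_real:
  assumes A: "sym_mat n A" and ev: "eigenvalue (map_mat complex_of_real A) z"
  shows "z \<in> \<real>"
proof -
  let ?C = "map_mat complex_of_real A"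
  have cA: "A \<in> carrier_mat n n" using A by (simp add: sym_mat_def)
  have C: "?C \<in> carrier_mat n n" using cA by simp
  have Csym: "?C $$ (i, j) = ?C $$ (j, i)" if "i < n" "j < n" for i j
    using that cA sym_mat_index[OF A that] by simp
  have Creal: "cnj (?C $$ (i, j)) = ?C $$ (i, j)" if "i < n" "j < n" for i j
    using that cA by simp
  obtain v where v: "v \<in> carrier_vec n" "v \<noteq> 0\<^sub>v n" "?C *\<^sub>v v = z \<cdot>\<^sub>v v"
    using ev C unfolding eigenvalue_def eigenvector_def by auto
  have row: "(\<Sum>j<n. ?C $$ (i, j) * v $ j) = z * v $ i" if "i < n" for i
  proof -
    have "(\<Sum>j<n. ?C $$ (i, j) * v $ j) = (?C *\<^sub>v v) $ i"
      using that C v(1) by (auto simp: scalar_prod_def atLeast0LessThan intro!: sum.cong)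
    then show ?thesis using v that by simp
  qed
  define N where "N = (\<Sum>i<n. (cmod (v $ i))\<^sup>2)"
  define q where "q = (\<Sum>i<n. \<Sum>j<n. cnj (v $ i) * ?C $$ (i, j) * v $ j)"
  have q: "q = z * of_real N"
  proof -
    have "q = (\<Sum>i<n. cnj (v $ i) * (z * v $ i))"
      unfolding q_def by (intro sum.cong) (auto simp: row[symmetric] sum_distrib_left mult.assoc)
    also have "\<dots> = z * of_real N"
      unfolding N_def of_real_sum sum_distrib_left
      by (intro sum.cong) (auto simp: complex_norm_square simp del: of_real_power)
    finally show ?thesis .
  qed
  have "cnj q = (\<Sum>i<n. \<Sum>j<n. v $ i * ?C $$ (i, j) * cnj (v $ j))"
    unfolding q_def cnj_sum using Creal by (intro sum.cong) (auto simp del: index_map_mat)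
  also have "\<dots> = q"
    unfolding q_def by (subst sum.swap, intro sum.cong) (auto simp: Csym simp del: index_map_mat)
  finally have "cnj z * of_real N = z * of_real N"
    by (simp add: q)
  moreover have "N \<noteq> 0"
  proof
    assume "N = 0"
    then have "\<forall>i<n. v $ i = 0"
      unfolding N_def by (subst (asm) sum_nonneg_eq_0_iff) auto
    then have "v = 0\<^sub>v n" using v(1) by (intro eq_vecI) auto
    with v(2) show False by simp
  qed
  ultimately have "cnj z = z" by simp
  then show ?thesis by (simp add: Reals_cnj_iff)
qed

text \<open>
By symmetry the trace of $A^2$ is the sum of the squares of all entries, hence nonzero.
This gives a nonzero complex eigenvalue, which is real.
\<close>

lemma sym_mat_nonzero_eigenvalue:
  assumes A: "sym_mat n A" "A \<noteq> 0\<^sub>m n n"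
  obtains x where "eigenvalue A x" "x \<noteq> 0"
proof -
  let ?C = "map_mat complex_of_real A"
  have cA: "A \<in> carrier_mat n n" using A by (simp add: sym_mat_def)
  have sym: "A $$ (j, i) = A $$ (i, j)" if "i < n" "j < n" for i j
    using sym_mat_index[OF A(1) that] by simp
  have C: "?C \<in> carrier_mat n n" using cA by simp
  define S where "S = (\<Sum>i<n. \<Sum>j<n. (A $$ (i, j))\<^sup>2)"
  have "trace_mat (?C * ?C) = of_real S"
    unfolding trace_mat_mult[OF C C] S_def of_real_sum
    using cA sym by (intro sum.cong) (auto simp: power2_eq_square)
  moreover have "S \<noteq> 0"
  proof
    assume "S = 0"
    then have "\<forall>i<n. (\<Sum>j<n. (A $$ (i, j))\<^sup>2) = 0"
      unfolding S_def by (subst (asm) sum_nonneg_eq_0_iff) (auto intro: sum_nonneg)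
    then have "\<forall>i<n. \<forall>j<n. A $$ (i, j) = 0"
      by (auto simp: sum_nonneg_eq_0_iff)
    then have "A = 0\<^sub>m n n" using cA by (intro eq_matI) auto
    with A(2) show False by simp
  qed
  ultimately obtain z where z: "eigenvalue ?C z" "z \<noteq> 0"
    using nonzero_eigenvalue_if_trace_square_nonzero[OF C] by auto
  then obtain x where x: "z = of_real x"
    using eigenvalue_of_symmetric_is_real[OF A(1)] by (auto elim: Reals_cases)
  have "poly (char_poly ?C) z = of_real (poly (char_poly A) x)"
    unfolding of_real_hom.char_poly_hom[OF cA] x by simp
  then have "eigenvalue A x"
    using z(1) by (simp add: eigenvalue_root_char_poly[OF C] eigenvalue_root_char_poly[OF cA])
  with x z(2) that show thesis by auto
qed

lemma set_mset_eigs: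
  assumes "A \<in> carrier_mat n n"
  shows "set_mset (eigs A) = spectrum A"
proof -
  have "char_poly A \<noteq> 0" using degree_monic_char_poly[OF assms] by auto
  then show ?thesis
    by (simp add: eigs_def spectrum_root_char_poly[OF assms])
qed

lemma op_norm_props:
  assumes A: "sym_mat n A" "A \<noteq> 0\<^sub>m n n"
  shows op_norm_pos: "op_norm A > 0"
    and op_norm_attained: "\<exists>l\<in>#eigs A. \<bar>l\<bar> = op_norm A"
    and abs_eig_le_op_norm: "\<And>l. l \<in># eigs A \<Longrightarrow> \<bar>l\<bar> \<le> op_norm A"
proof -
  have cA: "A \<in> carrier_mat n n" using A by (simp add: sym_mat_def)
  obtain x where x: "x \<in> spectrum A" "x \<noteq> 0"
    using sym_mat_nonzero_eigenvalue[OF A] by (auto simp: spectrum_def)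
  have fin: "finite (abs ` spectrum A)" using card_finite_spectrum(1)[OF cA] by simp
  show le: "\<bar>l\<bar> \<le> op_norm A" if "l \<in># eigs A" for l
    using that fin unfolding set_mset_eigs[OF cA] op_norm_def by simp
  have "op_norm A \<in> abs ` spectrum A"
    unfolding op_norm_def using fin x by (intro Max_in) auto
  then show "\<exists>l\<in>#eigs A. \<bar>l\<bar> = op_norm A"
    unfolding set_mset_eigs[OF cA] by auto
  show "op_norm A > 0"
    using le[of x] x unfolding set_mset_eigs[OF cA] by linarith
qed

section \<open>Schatten norms of large exponent\<close>

lemma sum_mset_nonneg_real:
  "(\<And>x. x \<in># M \<Longrightarrow> (0 :: real) \<le> f x) \<Longrightarrow> 0 \<le> (\<Sum>x\<in>#M. f x)"
  by (induction M) auto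

text \<open>
Among the nonnegative summands $|\lambda|^p$ one equals $\|A\|^p$, and none is larger.
\<close>

lemma schatten_norm_bounds:
  assumes A: "sym_mat n A" "A \<noteq> 0\<^sub>m n n" and p: "p > 0"
  shows "op_norm A \<le> schatten_norm p A"
    and "schatten_norm p A \<le> real (size (eigs A)) powr (1 / p) * op_norm A"
proof -
  let ?s = "op_norm A" and ?S = "\<Sum>l\<in>#eigs A. \<bar>l\<bar> powr p"
  note s = op_norm_props[OF A]
  have root: "(?s powr p) powr (1 / p) = ?s"
    using s(1) p by (simp add: powr_powr)
  obtain l where l: "l \<in># eigs A" "\<bar>l\<bar> = ?s" using s(2) by blast
  have "?S = \<bar>l\<bar> powr p + (\<Sum>l\<in>#eigs A - {#l#}. \<bar>l\<bar> powr p)"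
    by (subst insert_DiffM[OF l(1), symmetric], subst image_mset_add_mset, simp)
  then have "?s powr p \<le> ?S"
    using l(2) by (auto intro!: sum_mset_nonneg_real)
  then have "(?s powr p) powr (1 / p) \<le> ?S powr (1 / p)"
    using p by (intro powr_mono2) auto
  then show "?s \<le> schatten_norm p A"
    by (simp add: root schatten_norm_def)
  have "?S \<le> (\<Sum>l\<in>#eigs A. ?s powr p)"
    using s(3) p by (intro sum_mset_mono powr_mono2) auto
  also have "\<dots> = real (size (eigs A)) * ?s powr p"
    by simp
  finally have "?S powr (1 / p) \<le> (real (size (eigs A)) * ?s powr p) powr (1 / p)"
    using p by (intro powr_mono2) (auto intro!: sum_mset_nonneg_real)
  then show "schatten_norm p A \<le> real (size (eigs A)) powr (1 / p) * ?s"
    by (simp add: root schatten_norm_def powr_mult)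
qed

lemma schatten_norm_tendsto_op_norm:
  assumes A: "sym_mat n A" "A \<noteq> 0\<^sub>m n n"
  shows "(\<lambda>m. schatten_norm (real m + 1) A) \<longlonglongrightarrow> op_norm A"
proof -
  define N where "N = real (size (eigs A))"
  have "eigs A \<noteq> {#}" using op_norm_attained[OF A] by auto
  then have "N > 0" by (simp add: N_def nonempty_has_size)
  then have "(\<lambda>m. N powr (1 / (real m + 1)) * op_norm A) \<longlonglongrightarrow> op_norm A"
    by real_asymp
  then show ?thesis
    using schatten_norm_bounds[OF A, of "real m + 1" for m]
    by (rule_tac real_tendsto_sandwich[OF _ _ tendsto_const]) (simp_all add: N_def)
qed

section \<open>The coefficients theta and kappa\<close>

lemma sums_neg_ln_one_minus:
  fixes b :: real
  assumes "0 < b" "b < 1"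
  shows "(\<lambda>k. b ^ k / real k) sums (- ln (1 - b))"
proof -
  have "(\<lambda>k. - (- ((- (- b)) ^ k) / real k)) sums (- ln (1 + - b))"
    using ln_series'[of "- b"] assms by (intro sums_minus) auto
  then show ?thesis by simp
qed

text \<open>
Up to sign, $\theta_m(b)$ is the remainder of the series of $\ln(1-b)$ after degree $m$, scaled so that
its leading power of $b$ is constant.  The nonnegative coefficients of this expansion make both the
monotonicity in $b$ and the bounds on $\theta_m$ evident term by term.
\<close>

lemma theta_sums:
  assumes "0 < b" "b < 1"
  shows "(\<lambda>j. b ^ j / real (m + 1 + j)) sums theta m b"
proof -
  have "(\<lambda>j. b ^ (j + (m + 1)) / real (j + (m + 1)))
      sums (- ln (1 - b) - (\<Sum>k<m + 1. b ^ k / real k))"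
    by (rule sums_split_initial_segment[OF sums_neg_ln_one_minus[OF assms]])
  also have "(\<Sum>k<m + 1. b ^ k / real k) = (\<Sum>k=1..m. b ^ k / real k)"
    by (rule sum.mono_neutral_right) (auto simp: not_less_eq_eq)
  finally have "(\<lambda>j. b ^ (j + (m + 1)) / real (j + (m + 1)) / b ^ (m + 1))
      sums ((- ln (1 - b) - (\<Sum>k=1..m. b ^ k / real k)) / b ^ (m + 1))"
    by (rule sums_divide)
  also have "(\<lambda>j. b ^ (j + (m + 1)) / real (j + (m + 1)) / b ^ (m + 1))
      = (\<lambda>j. b ^ j / real (m + 1 + j))"
    using assms by (simp add: power_add add.commute)
  also have "(- ln (1 - b) - (\<Sum>k=1..m. b ^ k / real k)) / b ^ (m + 1) = theta m b"
    by (simp add: theta_def diff_divide_distrib add_divide_distrib)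
  finally show ?thesis .
qed

lemma theta_mono:
  assumes "0 < a" "a \<le> b" "b < 1"
  shows "theta m a \<le> theta m b"
  using assms by (intro sums_le[OF _ theta_sums theta_sums] divide_right_mono power_mono) auto

lemma theta_bounds:
  assumes "0 < b" "b < 1"
  shows "1 \<le> (real m + 1) * theta m b" and "(real m + 1) * theta m b \<le> 1 / (1 - b)"
proof -
  have s: "(\<lambda>j. (real m + 1) * (b ^ j / real (m + 1 + j))) sums ((real m + 1) * theta m b)"
    by (intro sums_mult theta_sums assms)
  have "(\<lambda>j. if j = 0 then 1 else 0 :: real) sums 1"
    using sums_single[of 0 "\<lambda>_. 1 :: real"] by simp
  then show "1 \<le> (real m + 1) * theta m b"
    using assms by (intro sums_le[OF _ _ s]) auto
  show "(real m + 1) * theta m b \<le> 1 / (1 - b)"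
  proof (rule sums_le[OF _ s])
    show "(\<lambda>j. b ^ j) sums (1 / (1 - b))"
      using assms by (intro geometric_sums) auto
    show "(real m + 1) * (b ^ j / real (m + 1 + j)) \<le> b ^ j" for j
      using assms by (simp add: field_simps)
  qed
qed

text \<open>
The quantity $(m+1)\theta_m(b)$ stays between $1$ and $1/(1-b)$, so its $m$-th root tends to $1$; since
$b < 1$, the minimum in $\kappa_m(b)$ tends to $b$.
\<close>

lemma kappa_tendsto:
  assumes "0 < b" "b < 1"
  shows "(\<lambda>m. kappa m b) \<longlonglongrightarrow> b / 2"
proof -
  let ?g = "\<lambda>m. 1 / ((real m + 1) * theta m b) powr (1 / real m)"
  have lower: "(\<lambda>m. 1 / (1 / (1 - b)) powr (1 / real m)) \<longlonglongrightarrow> 1"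
    using assms by real_asymp
  have "?g \<longlonglongrightarrow> 1"
  proof (rule real_tendsto_sandwich[OF _ _ lower tendsto_const])
    show "\<forall>\<^sub>F m in sequentially. 1 / (1 / (1 - b)) powr (1 / real m) \<le> ?g m"
    proof (intro always_eventually allI divide_left_mono powr_mono2)
      fix m
      have pos: "(real m + 1) * theta m b > 0" using theta_bounds(1)[OF assms, of m] by linarith
      then show "0 \<le> (real m + 1) * theta m b" by simp
      show "0 < (1 / (1 - b)) powr (1 / real m) * ((real m + 1) * theta m b) powr (1 / real m)"
        using less_imp_neq[OF pos] assms
        by (intro mult_pos_pos) (simp_all only: powr_gt_zero, auto)
    qed (use theta_bounds(2)[OF assms] in auto)
    show "\<forall>\<^sub>F m in sequentially. ?g m \<le> 1"
      using theta_bounds(1)[OF assms]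
      by (intro always_eventually allI) (simp add: divide_le_eq_1 ge_one_powr_ge_zero)
  qed
  moreover have "(\<lambda>m. real m / (2 * (real m + 1))) \<longlonglongrightarrow> 1 / 2"
    by real_asymp
  ultimately have "(\<lambda>m. real m / (2 * (real m + 1)) * min (?g m) b) \<longlonglongrightarrow> 1 / 2 * min 1 b"
    by (intro tendsto_mult tendsto_min tendsto_const)
  then show ?thesis
    using assms by (simp add: kappa_def min_def)
qed

text \<open>
In this form the equation says that the two arguments $1/(2\theta_1(b))$ and $b$ of the minimum in
$\kappa_1(b)$ coincide.
\<close>

lemma b_star_equation_iff:
  assumes "0 < b" "b < 1"
  shows "ln (1 - b) = - (3 / 2) * b \<longleftrightarrow> b * (2 * theta 1 b) = 1"
proof -
  have "b * (2 * theta 1 b) = - 2 * (ln (1 - b) + b) / b"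
    using assms by (simp add: theta_def power2_eq_square field_simps)
  then have "b * (2 * theta 1 b) = 1 \<longleftrightarrow> - 2 * (ln (1 - b) + b) = b"
    using assms by (simp only: divide_eq_1_iff) auto
  moreover have "- 2 * (ln (1 - b) + b) = b \<longleftrightarrow> ln (1 - b) = - (3 / 2) * b" by argo
  ultimately show ?thesis by blast
qed

lemma ln_2_less_three_quarters: "ln 2 < (3 / 4 :: real)"
proof -
  have "2 < (1 + 3 / 4 + (3 / 4)\<^sup>2 / 2 :: real)" by (simp add: power2_eq_square)
  also have "\<dots> \<le> exp (3 / 4)" by (rule exp_lower_Taylor_quadratic) simp
  finally show ?thesis by (metis exp_less_cancel_iff exp_ln zero_less_numeral)
qed

text \<open>
Existence is an intermediate value argument on $[\frac12, 1 - e^{-3/2}]$: the right end point is where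
$\ln(1-b) = -\frac32$, so that $\ln(1-b) + \frac32 b$ is negative there.  Uniqueness holds because
$b\,\theta_1(b)$ is strictly increasing.
\<close>

lemma b_star_props: "0 < b_star" "b_star < 1" "b_star * (2 * theta 1 b_star) = 1"
proof -
  let ?P = "\<lambda>b::real. 0 < b \<and> b < 1 \<and> ln (1 - b) = - (3 / 2) * b"
  let ?f = "\<lambda>b::real. ln (1 - b) + 3 / 2 * b"
  let ?u = "1 - exp (- 3 / 2) :: real"
  have e: "exp (- 3 / 2) < (1/2::real)"
  proof -
    have "1 + 3 / 2 \<le> exp (3 / 2 :: real)" by (rule exp_ge_add_one_self)
    then show ?thesis by (simp add: exp_minus field_simps)
  qed
  have "\<exists>b\<ge>1/2. b \<le> ?u \<and> ?f b = 0"
  proof (rule IVT2')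
    show "?f ?u \<le> 0" by simp
    show "0 \<le> ?f (1/2)" using ln_2_less_three_quarters by (simp add: ln_div)
    show "1/2 \<le> ?u" using e by simp
    show "continuous_on {1/2..?u} ?f"
    proof (intro continuous_intros ballI)
      fix b assume "b \<in> {1/2..?u}"
      then have "b \<le> ?u" by simp
      then have "b < 1" by (rule le_less_trans) simp
      then show "1 - b \<noteq> 0" by simp
    qed
  qed
  then obtain b where b_root: "b \<ge> 1/2" "b \<le> ?u" "?f b = 0" by blast
  have "b < 1" by (rule le_less_trans[OF b_root(2)]) simp
  then have b: "?P b" using b_root(1,3) by auto
  have no: "\<not> x < y" if "?P x" "?P y" for x y
  proof
    assume "x < y"
    have "x * (2 * theta 1 x) < y * (2 * theta 1 y)"
      using that \<open>x < y\<close> theta_mono[of x y 1] theta_bounds(1)[of x 1]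
      by (intro mult_less_le_imp_less) auto
    then show False using that b_star_equation_iff by force
  qed
  have "?P b_star"
    unfolding b_star_def
  proof (rule theI[of ?P, OF b])
    show "x = b" if "?P x" for x
      using no[OF that b] no[OF b that] by linarith
  qed
  then show "0 < b_star" "b_star < 1" "b_star * (2 * theta 1 b_star) = 1"
    using b_star_equation_iff by auto
qed

text \<open>
The minimum in $\kappa_1(b)$ is at most $b^*$: for $b \le b^*$ because of its argument $b$, and for
$b > b^*$ because its argument $1/(2\theta_1(b))$ decreases in $b$ and equals $b^*$ at $b^*$.
\<close>

lemma kappa_1_le_kappa_star:
  assumes "0 < b" "b < 1"
  shows "kappa 1 b \<le> kappa_star"
proof -
  note bs = b_star_props
  have th: "2 * theta 1 b \<ge> 1" using theta_bounds(1)[OF assms, of 1] by simp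
  have "min (1 / (2 * theta 1 b)) b \<le> b_star"
  proof (cases "b \<le> b_star")
    case False
    then have "b_star * (2 * theta 1 b_star) \<le> b_star * (2 * theta 1 b)"
      using bs theta_mono[of b_star b 1] assms by (intro mult_left_mono) auto
    then have "1 / (2 * theta 1 b) \<le> b_star"
      using bs(3) th by (simp add: divide_le_eq)
    then show ?thesis by simp
  qed simp
  then show ?thesis
    using th by (simp add: kappa_def kappa_star_def)
qed

section \<open>The bounds at m = 1 and in the limit\<close>

lemma tail_bound_le:
  assumes "0 < b" "b < 1"
  shows "tail_bound A m t \<le> exp (Lambda A m t b)"
  unfolding tail_bound_def using assms
  by (intro cINF_lower bdd_belowI2[of _ 0]) auto

lemma tail_bound_1_ge:
  assumes "op_norm A > 0" "t > 0"
  shows "exp (- kappa_star * min (t\<^sup>2 / (schatten_norm 2 A)\<^sup>2) (t / op_norm A)) \<le> tail_bound A 1 t"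
proof -
  let ?M = "min (t\<^sup>2 / (schatten_norm 2 A)\<^sup>2) (t / op_norm A)"
  have M: "?M \<ge> 0" using assms by simp
  have nn: "schatten_norm 2 A \<ge> 0" by (simp add: schatten_norm_def)
  have "Lambda A 1 t b = - kappa 1 b * ?M" for b
    using assms nn by (simp add: Lambda_def)
  moreover have "- kappa_star * ?M \<le> - kappa 1 b * ?M" if "0 < b" "b < 1" for b
    using kappa_1_le_kappa_star[OF that] M by (simp add: mult_right_mono)
  ultimately show ?thesis
    unfolding tail_bound_def by (intro cINF_greatest) auto
qed

text \<open>
The truncated logarithm series converges, and the two arguments of the minimum have the same
limit $t/\|A\|$.
\<close>

lemma Lambda_tendsto:
  assumes A: "sym_mat n A" "A \<noteq> 0\<^sub>m n n" and b: "0 < b" "b < 1" and t: "t > 0"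
  shows "(\<lambda>m. Lambda A m t b)
    \<longlonglongrightarrow> real (mat_rank A) / 2 * (- ln (1 - b) - b) - b / 2 * (t / op_norm A)"
proof -
  let ?s = "op_norm A"
  have s: "?s > 0" by (rule op_norm_pos[OF A])
  have e: "(\<lambda>m. 1 + 1 / real m) \<longlonglongrightarrow> 1" by real_asymp
  have "(\<lambda>m. min (t powr (1 + 1 / real m) / schatten_norm (real m + 1) A powr (1 + 1 / real m)) (t / ?s))
      \<longlonglongrightarrow> min (t powr 1 / ?s powr 1) (t / ?s)"
    using s t by (intro tendsto_intros e schatten_norm_tendsto_op_norm[OF A]) auto
  then have mn: "(\<lambda>m. min (t powr (1 + 1 / real m) / schatten_norm (real m + 1) A powr (1 + 1 / real m)) (t / ?s))
      \<longlonglongrightarrow> t / ?s"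
    using s t by simp
  have "(\<lambda>m. \<Sum>k\<le>m. b ^ k / real k) \<longlonglongrightarrow> - ln (1 - b)"
    using sums_neg_ln_one_minus[OF b] by (simp add: sums_def_le)
  then have "(\<lambda>m. (\<Sum>k\<le>m. b ^ k / real k) - b) \<longlonglongrightarrow> - ln (1 - b) - b"
    by (intro tendsto_intros)
  moreover have "\<forall>\<^sub>F m in sequentially. (\<Sum>k\<le>m. b ^ k / real k) - b = (\<Sum>k=2..m. b ^ k / real k)"
    using eventually_ge_at_top[of 1]
  proof eventually_elim
    case (elim m)
    have "(\<Sum>k\<le>m. b ^ k / real k) = (\<Sum>k\<in>{1..m}. b ^ k / real k)"
      by (rule sum.mono_neutral_right) (auto simp: not_less_eq_eq)
    also have "\<dots> = b + (\<Sum>k=2..m. b ^ k / real k)"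
      using elim by (simp add: sum.atLeast_Suc_atMost numeral_2_eq_2)
    finally show ?case by simp
  qed
  ultimately have "(\<lambda>m. \<Sum>k=2..m. b ^ k / real k) \<longlonglongrightarrow> - ln (1 - b) - b"
    by (rule Lim_transform_eventually)
  then show ?thesis
    unfolding Lambda_def by (intro tendsto_intros mn kappa_tendsto b)
qed

section \<open>Beyond the largest solution\<close>

text \<open>
The left-hand side of the threshold equation is twice the amount by which the minimal limiting exponent
exceeds the exponent $-\kappa M(t)$ attached to $m = 1$.
\<close>

definition exponent_gap :: "real mat \<Rightarrow> real \<Rightarrow> real" where
  "exponent_gap A t = real (mat_rank A) * ln (1 + t / (real (mat_rank A) * op_norm A)) - t / op_norm A
       + 2 * kappa_star * min (t\<^sup>2 / (schatten_norm 2 A)\<^sup>2) (t / op_norm A)"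

lemma threshold_eq_iff: "threshold_eq A t \<longleftrightarrow> exponent_gap A t = 0"
  by (simp add: threshold_eq_def exponent_gap_def)

lemma limit_beats_first_bound:
  assumes A: "sym_mat n A" "A \<noteq> 0\<^sub>m n n" and r: "mat_rank A > 0" and t: "t > 0"
    and gap: "exponent_gap A t < 0"
  shows "\<exists>m\<ge>1. tail_bound A m t < tail_bound A 1 t"
proof -
  let ?s = "op_norm A" and ?r = "real (mat_rank A)"
  let ?M = "min (t\<^sup>2 / (schatten_norm 2 A)\<^sup>2) (t / ?s)"
  have s: "?s > 0" by (rule op_norm_pos[OF A])
  \<comment> \<open>The critical point of the limiting exponent: its derivative in \<open>b\<close> is half of
    \<open>r / (1 - b) - r - t / s\<close>.\<close>
  define b where "b = t / (?r * ?s + t)"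
  have rs: "?r * ?s > 0" using r s by simp
  have b: "0 < b" "b < 1" using t rs by (auto simp: b_def)
  have denom: "?r * ?s + t \<noteq> 0" using rs t by linarith
  have "1 - b = ?r * ?s / (?r * ?s + t)"
    unfolding b_def using denom by (subst eq_divide_eq) (simp add: left_diff_distrib)
  also have "\<dots> = 1 / (1 + t / (?r * ?s))"
    using rs s r t by (simp add: field_simps)
  finally have "1 - b = 1 / (1 + t / (?r * ?s))" .
  then have "ln (1 - b) = - ln (1 + t / (?r * ?s))"
    using t rs by (simp add: ln_div)
  moreover have "b * (?r + t / ?s) = t / ?s"
  proof -
    have "?r + t / ?s = (?r * ?s + t) / ?s" using s by (simp add: field_simps)
    then show ?thesis using denom by (simp add: b_def)
  qed
  ultimately have "?r / 2 * (- ln (1 - b) - b) - b / 2 * (t / ?s)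
      = (?r * ln (1 + t / (?r * ?s)) - t / ?s) / 2"
    by (simp add: algebra_simps)
  also have "\<dots> < - kappa_star * ?M"
  proof -
    have "x / 2 < - k * M" if "x + 2 * k * M < 0" for x k M :: real
      using that by simp
    then show ?thesis using gap unfolding exponent_gap_def .
  qed
  finally have "\<forall>\<^sub>F m in sequentially. Lambda A m t b < - kappa_star * ?M"
    by (rule order_tendstoD(2)[OF Lambda_tendsto[OF A b t]])
  then obtain m where m: "m \<ge> 1" "Lambda A m t b < - kappa_star * ?M"
    using eventually_ge_at_top[of 1] by (metis (mono_tags, lifting) eventually_conj eventually_sequentially order_refl)
  have "tail_bound A m t \<le> exp (Lambda A m t b)" by (rule tail_bound_le[OF b])
  also have "\<dots> < exp (- kappa_star * ?M)" using m by simp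
  also have "\<dots> \<le> tail_bound A 1 t" by (rule tail_bound_1_ge[OF s t])
  finally show ?thesis using m by blast
qed

text \<open>
Replacing the minimum by its linear argument leaves a linear term with negative coefficient, because
$2\kappa = b^*/2 < 1$; this controls the sign both for large $t$ and for rank zero.
\<close>

lemma exponent_gap_le:
  assumes "op_norm A > 0" "t > 0"
  shows "exponent_gap A t \<le> real (mat_rank A) * ln (1 + t / (real (mat_rank A) * op_norm A))
     - (1 - 2 * kappa_star) * (t / op_norm A)"
proof -
  have "kappa_star * min (t\<^sup>2 / (schatten_norm 2 A)\<^sup>2) (t / op_norm A) \<le> kappa_star * (t / op_norm A)"
    using b_star_props by (intro mult_left_mono) (auto simp: kappa_star_def)
  then have "2 * kappa_star * min (t\<^sup>2 / (schatten_norm 2 A)\<^sup>2) (t / op_norm A)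
      \<le> 2 * kappa_star * (t / op_norm A)"
    by linarith
  moreover have "(1 - 2 * kappa_star) * (t / op_norm A)
      = t / op_norm A - 2 * kappa_star * (t / op_norm A)"
    by (simp only: left_diff_distrib mult_1)
  ultimately show ?thesis unfolding exponent_gap_def by linarith
qed

lemma rank_pos_if_solution:
  assumes s: "op_norm A > 0" and "t > 0" "threshold_eq A t"
  shows "mat_rank A > 0"
proof (rule ccontr)
  assume "\<not> ?thesis"
  then have "0 \<le> - ((1 - 2 * kappa_star) * (t / op_norm A))"
    using exponent_gap_le[OF s \<open>t > 0\<close>] assms by (simp add: threshold_eq_iff)
  moreover have "(1 - 2 * kappa_star) * (t / op_norm A) > 0"
    using assms b_star_props by (intro mult_pos_pos) (auto simp: kappa_star_def)
  ultimately show False by linarith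
qed

lemma exponent_gap_eventually_neg:
  assumes s: "op_norm A > 0" and r: "mat_rank A > 0"
  shows "\<forall>\<^sub>F t in at_top. exponent_gap A t < 0"
proof -
  define s r c where "s = op_norm A" and "r = real (mat_rank A)" and "c = 1 - 2 * kappa_star"
  have "s > 0" "r > 0" "c > 0"
    using assms b_star_props by (auto simp: s_def r_def c_def kappa_star_def)
  then have "\<forall>\<^sub>F t in at_top. r * ln (1 + t / (r * s)) - c * (t / s) < 0"
    by real_asymp
  then show ?thesis
    using eventually_gt_at_top[of 0]
  proof eventually_elim
    case (elim t)
    then show ?case using exponent_gap_le[OF s, of t] by (simp add: s_def r_def c_def)
  qed
qed

lemma continuous_on_exponent_gap:
  assumes s: "op_norm A > 0" and r: "mat_rank A > 0"
  shows "continuous_on {0..} (exponent_gap A)"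
proof -
  have "1 + t / (real (mat_rank A) * op_norm A) > 0" if "t \<ge> 0" for t
    using that s r by (intro add_pos_nonneg) auto
  then show ?thesis
    unfolding exponent_gap_def divide_inverse
    by (intro continuous_intros ballI) (force simp: divide_inverse)
qed

text \<open>
A zero exists and all zeros lie below a point after which the function is negative; a closed bounded set
of zeros has a largest element.  A nonnegative value beyond it would force another zero.
\<close>

lemma largest_zero:
  fixes f :: "real \<Rightarrow> real"
  assumes cont: "continuous_on {0..} f" and neg: "\<forall>\<^sub>F t in at_top. f t < 0"
    and ex: "a > 0" "f a = 0"
  defines "z \<equiv> GREATEST t. 0 < t \<and> f t = 0"
  shows "z > 0" and "\<And>t. t > z \<Longrightarrow> f t < 0"
proof -
  obtain T where T: "\<And>t. t \<ge> T \<Longrightarrow> f t < 0"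
    using neg by (auto simp: eventually_at_top_linorder)
  have zero_le: "t \<le> T" if "f t = 0" for t
    using that T[of t] by force
  let ?Z = "{t \<in> {a..T}. f t = 0}"
  have "closed ?Z"
    using ex by (intro continuous_closed_preimage_constant continuous_on_subset[OF cont]) auto
  then have "compact ?Z"
    using compact_Int_closed[OF compact_Icc, of ?Z a T] by (simp add: Int_absorb1 subset_eq)
  moreover have "a \<in> ?Z" using ex zero_le by auto
  ultimately obtain y where y: "y \<in> ?Z" "\<And>t. t \<in> ?Z \<Longrightarrow> t \<le> y"
    using compact_attains_sup[of ?Z] by blast
  have max: "t \<le> y" if "f t = 0" for t
    using that y zero_le by (cases "a \<le> t") auto
  have z: "z = y"
    unfolding z_def using y(1) ex(1) max by (intro Greatest_equality) auto
  show "z > 0" using z y ex by auto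
  show "f t < 0" if "t > z" for t
  proof (rule ccontr)
    assume "\<not> f t < 0"
    moreover have "f (max t T) < 0" using T by simp
    moreover have "continuous_on {t..max t T} f"
      using \<open>z > 0\<close> that by (intro continuous_on_subset[OF cont]) auto
    ultimately have "\<exists>x\<ge>t. x \<le> max t T \<and> f x = 0"
      by (intro IVT2') simp_all
    then obtain x where "t \<le> x" "f x = 0" by blast
    then show False using max[of x] that z by simp
  qed
qed

section \<open>The critical threshold\<close>

text \<open>
Between two thresholds $x < y$ the limit of the bounds would lie strictly below the bound for $m = 1$ (by
the property of $x$) and, as a limit of numbers at least as large as that bound, not below it (by the
property of $y$).
\<close>

lemma critical_threshold_unique:
  assumes "is_critical_threshold A x" "is_critical_threshold A y"
  shows "\<not> x < y"
proof
  assume "x < y"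
  then obtain t where t: "x < t" "t < y" using dense by blast
  have "x \<ge> 0" using assms by (simp add: is_critical_threshold_def)
  then obtain L where L: "(\<lambda>m. tail_bound A m t) \<longlonglongrightarrow> L" "L < tail_bound A 1 t"
    using assms(1) t by (auto simp: is_critical_threshold_def)
  have "\<forall>m\<ge>1. tail_bound A 1 t \<le> tail_bound A m t"
    using assms(2) t \<open>x \<ge> 0\<close> by (simp add: is_critical_threshold_def)
  then have "tail_bound A 1 t \<le> L"
    by (intro LIMSEQ_le_const[OF L(1)]) blast
  with L(2) show False by simp
qed

lemma critical_threshold_is_critical:
  assumes "phase_transition_conjecture" "sym_mat n A" "A \<noteq> 0\<^sub>m n n"
  shows "is_critical_threshold A (critical_threshold A)"
proof -
  obtain \<tau> where "is_critical_threshold A \<tau>"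
    using assms unfolding phase_transition_conjecture_def by blast
  moreover have "x = \<tau>" if "is_critical_threshold A x" for x
    using critical_threshold_unique[OF that calculation] critical_threshold_unique[OF calculation that]
    by linarith
  ultimately show ?thesis
    unfolding critical_threshold_def by (rule theI)
qed

theorem corollary2:
  fixes A :: "real mat" and n :: nat
  assumes "phase_transition_conjecture"
    and "sym_mat n A" and "A \<noteq> 0\<^sub>m n n"
    and "\<exists>t>0. threshold_eq A t"
  shows "critical_threshold A \<le> largest_solution A"
proof (rule ccontr)
  assume "\<not> ?thesis"
  then obtain t where t: "largest_solution A < t" "t < critical_threshold A"
    using dense[of "largest_solution A" "critical_threshold A"] by auto
  have s: "op_norm A > 0" using op_norm_pos assms by blast
  then have r: "mat_rank A > 0" using rank_pos_if_solution assms by blast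
  obtain a where a: "a > 0" "exponent_gap A a = 0"
    using assms by (auto simp: threshold_eq_iff)
  have eq: "largest_solution A = (GREATEST t. 0 < t \<and> exponent_gap A t = 0)"
    by (simp add: largest_solution_def threshold_eq_iff)
  note largest = largest_zero[OF continuous_on_exponent_gap[OF s r]
      exponent_gap_eventually_neg[OF s r] a, folded eq]
  have "t > 0" using largest(1) t by simp
  then obtain m where "m \<ge> 1" "tail_bound A m t < tail_bound A 1 t"
    using limit_beats_first_bound[OF assms(2,3) r] largest(2) t by blast
  moreover have "tail_bound A 1 t \<le> tail_bound A m t"
    using critical_threshold_is_critical[OF assms(1-3)] t \<open>t > 0\<close> \<open>m \<ge> 1\<close>
    by (simp add: is_critical_threshold_def)
  ultimately show False by simp
qed

end
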